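(* Let $E$ be a separable Banach space, $\phi$ a Young integrand on $\Omega\times E$, and $(f_n)_n$ a sequence of measurable integrands $f_n:\Omega\times E\to\overline{\mathbb{R}}$ such that: for every $\epsilon>0$ and every $\lambda>0$ there exists a sequence $(u_n)_n$ of non negative uniformly integrable functions satisfying, for all $n$ large enough, $$f_n\ \ge\ -\epsilon\,\phi_\lambda(\cdot)-u_n .$$ Then the sequence of integrands $(f_n)_n$ has the Fréchet lower compactness property on $L_\phi(\Omega,E)$.
   Context: $(\Omega,\mathbb{T},\mu)$ is a measure space with $\mu$ a $\sigma$-finite positive measure and $\mathbb{T}$ $\mu$-complete. A measurable integrand is a $\mathbb{T}\otimes\mathcal{B}(E)$-measurable function $\Omega\times E\to\overline{\mathbb{R}}$. For integrands, $g\ge h$ means that there is a negligible set $N$ with $g(\omega,e)\ge h(\omega,e)$ for all $\omega\notin N$, $e\in E$. A Young function is a convex even function $E\to\overline{\mathbb{R}}_+$, continuous at $0$, vanishing at $0$, and tending to $+\infty$ as $\|e\|\to\infty$. A Young integrand is $\phi:\Omega\times E\to\overline{\mathbb{R}}_+$ with $\phi(\omega,\cdot)$ a Young function for every $\omega$; $\phi_\lambda(\omega,e)=\phi(\omega,\lambda e)$. With $I_\phi(x)=\int^*_\Omega\phi(\omega,x(\omega))\,d\mu$ (upper integral: $\int^*_\Omega v\,d\mu=\inf\{\int u\,d\mu: u\in L_1(\Omega,\mathbb{R}),u\ge v\text{ a.e.}\}$), $L_\phi(\Omega,E)$ is the set of classes of measurable $x:\Omega\to E$ with $x\in t\{I_\phi\le1\}$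 for some $t>0$, normed by $\|x\|_\phi=\inf\{t>0: x\in t\{I_\phi\le1\}\}$. A subset (or sequence) $X$ of $L_1(\Omega,\mathbb{R})$ is uniformly integrable if it is bounded in $L_1$ and for every $\epsilon>0$ there are $\eta>0$ and a measurable $K$ of finite measure with $\sup_{u\in X}\|u1_A\|_1<\epsilon$ whenever $\mu(A)\le\eta$, and $\sup_{u\in X}\|u1_{K^c}\|_1<\epsilon$. $(f_n)_n$ has the Fréchet lower compactness property on a normed space $\mathcal{X}$ of measurable functions if for every norm bounded sequence $(x_n)_n$ in $\mathcal{X}$ there is $n_0$ such that the sequence of negative parts $(f_n^-(x_n))_{n\ge n_0}$ is uniformly integrable in $L_1(\Omega,\mathbb{R})$, where $f_n(x_n)$ is the function $\omega\mapsto f_n(\omega,x_n(\omega))$. *)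

theory Defs
  imports "HOL-Analysis.Analysis"
begin

text \<open>
  Elements of \<open>L\<^sub>1\<close> and of \<open>L\<^sub>\<phi>\<close> are handled through representatives. Over a complete
  measure space the notions below do not depend on the choice of representatives.
\<close>

definition measurable_integrand ::
  "'a measure \<Rightarrow> ('a \<Rightarrow> 'e::topological_space \<Rightarrow> ereal) \<Rightarrow> bool" where
  "measurable_integrand M f \<longleftrightarrow>
     (\<lambda>(\<omega>, e). f \<omega> e) \<in> borel_measurable (M \<Otimes>\<^sub>M borel)"

text \<open>The negligible set does not depend on \<open>e\<close>.\<close>

definition integrand_ge ::
  "'a measure \<Rightarrow> ('a \<Rightarrow> 'e \<Rightarrow> ereal) \<Rightarrow> ('a \<Rightarrow> 'e \<Rightarrow> ereal) \<Rightarrow> bool" where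
  "integrand_ge M g h \<longleftrightarrow> (AE \<omega> in M. \<forall>e. g \<omega> e \<ge> h \<omega> e)"

text \<open>Convexity is spelled out because \<open>convex_on\<close> is for real-valued functions only;
  for nonnegative \<open>F\<close> the right-hand side is never of the form \<open>\<infinity> - \<infinity>\<close>.\<close>

definition young_function :: "('e::real_normed_vector \<Rightarrow> ereal) \<Rightarrow> bool" where
  "young_function F \<longleftrightarrow>
     (\<forall>e. 0 \<le> F e) \<and>
     (\<forall>x y. \<forall>t::real. 0 < t \<and> t < 1 \<longrightarrow>
        F (t *\<^sub>R x + (1 - t) *\<^sub>R y) \<le> ereal t * F x + ereal (1 - t) * F y) \<and>
     (\<forall>e. F (- e) = F e) \<and>
     isCont F 0 \<and>
     F 0 = 0 \<and>
     (F \<longlongrightarrow> \<infinity>) at_infinity"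

text \<open>No measurability in \<open>\<omega>\<close> is required, hence the upper integral below.\<close>

definition young_integrand ::
  "'a measure \<Rightarrow> ('a \<Rightarrow> 'e::real_normed_vector \<Rightarrow> ereal) \<Rightarrow> bool" where
  "young_integrand M \<phi> \<longleftrightarrow> (\<forall>\<omega>\<in>space M. young_function (\<phi> \<omega>))"

definition dilate ::
  "real \<Rightarrow> ('a \<Rightarrow> 'e::real_normed_vector \<Rightarrow> ereal) \<Rightarrow> 'a \<Rightarrow> 'e \<Rightarrow> ereal" where
  "dilate c \<phi> = (\<lambda>\<omega> e. \<phi> \<omega> (c *\<^sub>R e))"

text \<open>The value is \<open>\<infinity>\<close> when \<open>v\<close> has no integrable majorant.\<close>

definition upper_integral :: "'a measure \<Rightarrow> ('a \<Rightarrow> ereal) \<Rightarrow> ereal" where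
  "upper_integral M v =
     Inf {ereal (\<integral>\<omega>. u \<omega> \<partial>M) | u :: 'a \<Rightarrow> real.
            integrable M u \<and> (AE \<omega> in M. v \<omega> \<le> ereal (u \<omega>))}"

definition integral_functional ::
  "'a measure \<Rightarrow> ('a \<Rightarrow> 'e \<Rightarrow> ereal) \<Rightarrow> ('a \<Rightarrow> 'e) \<Rightarrow> ereal" where
  "integral_functional M \<phi> x = upper_integral M (\<lambda>\<omega>. \<phi> \<omega> (x \<omega>))"

text \<open>The dilated sublevel set \<open>t {I\<^sub>\<phi> \<le> 1}\<close>.\<close>

definition scaled_unit_sublevel ::
  "'a measure \<Rightarrow> ('a \<Rightarrow> 'e::real_normed_vector \<Rightarrow> ereal) \<Rightarrow> real \<Rightarrow> ('a \<Rightarrow> 'e) set" where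
  "scaled_unit_sublevel M \<phi> t =
     (\<lambda>y \<omega>. t *\<^sub>R y \<omega>) ` {y. y \<in> borel_measurable M \<and> integral_functional M \<phi> y \<le> 1}"

definition L_young ::
  "'a measure \<Rightarrow> ('a \<Rightarrow> 'e::real_normed_vector \<Rightarrow> ereal) \<Rightarrow> ('a \<Rightarrow> 'e) set" where
  "L_young M \<phi> = {x \<in> borel_measurable M. \<exists>t>0. x \<in> scaled_unit_sublevel M \<phi> t}"

text \<open>Meaningful on \<open>L_young M \<phi>\<close> only, where the infimum is over a nonempty set.\<close>

definition young_norm ::
  "'a measure \<Rightarrow> ('a \<Rightarrow> 'e::real_normed_vector \<Rightarrow> ereal) \<Rightarrow> ('a \<Rightarrow> 'e) \<Rightarrow> real" where
  "young_norm M \<phi> x = Inf {t. t > 0 \<and> x \<in> scaled_unit_sublevel M \<phi> t}"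

definition L1_norm :: "'a measure \<Rightarrow> ('a \<Rightarrow> real) \<Rightarrow> ennreal" where
  "L1_norm M u = (\<integral>\<^sup>+\<omega>. ennreal \<bar>u \<omega>\<bar> \<partial>M)"

text \<open>Suprema are taken in \<open>[0, \<infinity>]\<close>, so that the supremum over the empty family is \<open>0\<close>.\<close>

definition uniformly_integrable :: "'a measure \<Rightarrow> ('a \<Rightarrow> real) set \<Rightarrow> bool" where
  "uniformly_integrable M X \<longleftrightarrow>
     (\<forall>u\<in>X. integrable M u) \<and>
     (SUP u\<in>X. L1_norm M u) < \<infinity> \<and>
     (\<forall>\<epsilon>::real. \<epsilon> > 0 \<longrightarrow>
        (\<exists>\<eta>::real. \<exists>K. \<eta> > 0 \<and> K \<in> sets M \<and> emeasure M K < \<infinity> \<and>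
           (\<forall>A\<in>sets M. emeasure M A \<le> ennreal \<eta> \<longrightarrow>
              (SUP u\<in>X. L1_norm M (\<lambda>\<omega>. u \<omega> * indicator A \<omega>)) < ennreal \<epsilon>) \<and>
           (SUP u\<in>X. L1_norm M (\<lambda>\<omega>. u \<omega> * indicator (space M - K) \<omega>)) < ennreal \<epsilon>))"

definition negative_part :: "ereal \<Rightarrow> ereal" where
  "negative_part r = max 0 (- r)"

text \<open>
  The functions \<open>negative_part \<circ> f\<^sub>n(x\<^sub>n)\<close> are extended-real-valued. Being in \<open>L\<^sub>1(\<Omega>, \<real>)\<close>
  includes being finite almost everywhere; this has to be demanded separately because
  \<open>real_of_ereal \<infinity> = 0\<close>.
\<close>

definition frechet_lower_compactness ::
  "'a measure \<Rightarrow> ('a \<Rightarrow> 'e) set \<Rightarrow> (('a \<Rightarrow> 'e) \<Rightarrow> real) \<Rightarrow> (nat \<Rightarrow> 'a \<Rightarrow> 'e \<Rightarrow> ereal) \<Rightarrow> bool" where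
  "frechet_lower_compactness M \<X> nrm f \<longleftrightarrow>
     (\<forall>x :: nat \<Rightarrow> 'a \<Rightarrow> 'e.
        (\<forall>n. x n \<in> \<X>) \<and> (\<exists>R. \<forall>n. nrm (x n) \<le> R) \<longrightarrow>
        (\<exists>n0.
           (\<forall>n\<ge>n0. AE \<omega> in M. negative_part (f n \<omega> (x n \<omega>)) < \<infinity>) \<and>
           uniformly_integrable M
             ((\<lambda>n \<omega>. real_of_ereal (negative_part (f n \<omega> (x n \<omega>)))) ` {n0..})))"

end

theory Submission
  imports Defs
begin

text \<open>
  Fix a norm bounded sequence \<open>x\<^sub>n\<close> and a radius \<open>R\<close> strictly above all its norms. By convexity the
  functions \<open>\<phi>(\<cdot>, x\<^sub>n / R)\<close> have upper integral at most \<open>1\<close>, so they have integrable majorants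
  \<open>v\<^sub>n\<close> with \<open>\<integral> v\<^sub>n < 2\<close>. The hypothesis for the single dilation factor \<open>1 / R\<close> and arbitrary
  \<open>\<epsilon>\<close> then reads
  \<open>f\<^sub>n\<^sup>-(x\<^sub>n) \<le> \<epsilon> v\<^sub>n + u\<^sub>n\<close> for all large \<open>n\<close>: up to an error \<open>2 \<epsilon>\<close> in \<open>L\<^sub>1\<close>, the negative
  parts are dominated by a uniformly integrable family. Such approximate domination for every
  \<open>\<epsilon>\<close> implies uniform integrability (\<open>uniformly_integrable_approx_dominated\<close>).

  The rank from which the domination holds depends on \<open>\<epsilon>\<close>, whereas \<open>n\<^sub>0\<close> must not. So \<open>n\<^sub>0\<close> is the
  rank for \<open>\<epsilon> = 1\<close>, which already makes the negative parts integrable; for smaller \<open>\<epsilon>\<close> only finitely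
  many further functions remain, and they are added to the dominating family because a finite set
  of integrable functions is uniformly integrable (\<open>uniformly_integrable_finite\<close>).
\<close>

section \<open>Uniform integrability\<close>

text \<open>Bounding each member by \<open>\<epsilon>\<close> only gives \<open>\<le>\<close> for the supremum; the strict inequality comes
  from using \<open>\<epsilon> / 2\<close>.\<close>

lemma uniformly_integrableI:
  assumes int: "\<And>u. u \<in> X \<Longrightarrow> integrable M u"
    and bdd: "\<And>u. u \<in> X \<Longrightarrow> L1_norm M u \<le> C" and C: "C < \<infinity>"
    and small: "\<And>\<epsilon>::real. \<epsilon> > 0 \<Longrightarrow> \<exists>\<eta>::real. \<exists>K. \<eta> > 0 \<and> K \<in> sets M \<and> emeasure M K < \<infinity> \<and>
        (\<forall>u\<in>X. (\<forall>A\<in>sets M. emeasure M A \<le> ennreal \<eta> \<longrightarrow>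
                   L1_norm M (\<lambda>\<omega>. u \<omega> * indicator A \<omega>) \<le> ennreal \<epsilon>) \<and>
               L1_norm M (\<lambda>\<omega>. u \<omega> * indicator (space M - K) \<omega>) \<le> ennreal \<epsilon>)"
  shows "uniformly_integrable M X"
  unfolding uniformly_integrable_def
proof (intro conjI ballI allI impI)
  show "(SUP u\<in>X. L1_norm M u) < \<infinity>"
    using SUP_least[of X "L1_norm M" C] bdd C by (meson order_le_less_trans)
next
  fix \<epsilon> :: real assume "\<epsilon> > 0"
  then have half: "\<epsilon> / 2 > 0" "ennreal (\<epsilon> / 2) < ennreal \<epsilon>" by (auto simp: ennreal_less_iff)
  from small[OF half(1)] obtain \<eta> K where K: "\<eta> > 0" "K \<in> sets M" "emeasure M K < \<infinity>"
    and A: "\<And>u A. u \<in> X \<Longrightarrow> A \<in> sets M \<Longrightarrow> emeasure M A \<le> ennreal \<eta> \<Longrightarrow>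
                L1_norm M (\<lambda>\<omega>. u \<omega> * indicator A \<omega>) \<le> ennreal (\<epsilon> / 2)"
    and B: "\<And>u. u \<in> X \<Longrightarrow> L1_norm M (\<lambda>\<omega>. u \<omega> * indicator (space M - K) \<omega>) \<le> ennreal (\<epsilon> / 2)"
    by blast
  show "\<exists>\<eta> K. \<eta> > 0 \<and> K \<in> sets M \<and> emeasure M K < \<infinity> \<and>
           (\<forall>A\<in>sets M. emeasure M A \<le> ennreal \<eta> \<longrightarrow>
              (SUP u\<in>X. L1_norm M (\<lambda>\<omega>. u \<omega> * indicator A \<omega>)) < ennreal \<epsilon>) \<and>
           (SUP u\<in>X. L1_norm M (\<lambda>\<omega>. u \<omega> * indicator (space M - K) \<omega>)) < ennreal \<epsilon>"
    using K by (intro exI[of _ \<eta>] exI[of _ K])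
      (auto intro!: order_le_less_trans[OF SUP_least half(2)] A B)
qed (fact int)

lemma uniformly_integrableE:
  assumes "uniformly_integrable M X" "\<epsilon> > 0"
  obtains \<eta> :: real and K where "\<eta> > 0" "K \<in> sets M" "emeasure M K < \<infinity>"
    "\<And>u A. u \<in> X \<Longrightarrow> A \<in> sets M \<Longrightarrow> emeasure M A \<le> ennreal \<eta> \<Longrightarrow>
        L1_norm M (\<lambda>\<omega>. u \<omega> * indicator A \<omega>) \<le> ennreal \<epsilon>"
    "\<And>u. u \<in> X \<Longrightarrow> L1_norm M (\<lambda>\<omega>. u \<omega> * indicator (space M - K) \<omega>) \<le> ennreal \<epsilon>"
proof -
  from assms obtain \<eta> K where K: "\<eta> > 0" "K \<in> sets M" "emeasure M K < \<infinity>"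
    and A: "\<And>A. A \<in> sets M \<Longrightarrow> emeasure M A \<le> ennreal \<eta> \<Longrightarrow>
              (SUP u\<in>X. L1_norm M (\<lambda>\<omega>. u \<omega> * indicator A \<omega>)) < ennreal \<epsilon>"
    and B: "(SUP u\<in>X. L1_norm M (\<lambda>\<omega>. u \<omega> * indicator (space M - K) \<omega>)) < ennreal \<epsilon>"
    unfolding uniformly_integrable_def by blast
  show thesis
  proof (rule that[OF K])
    fix u assume u: "u \<in> X"
    show "L1_norm M (\<lambda>\<omega>. u \<omega> * indicator A \<omega>) \<le> ennreal \<epsilon>"
      if "A \<in> sets M" "emeasure M A \<le> ennreal \<eta>" for A
      using order_le_less_trans[OF SUP_upper[OF u] A[OF that]] by (rule less_imp_le)
    show "L1_norm M (\<lambda>\<omega>. u \<omega> * indicator (space M - K) \<omega>) \<le> ennreal \<epsilon>"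
      using order_le_less_trans[OF SUP_upper[OF u] B] by (rule less_imp_le)
  qed
qed

lemma L1_norm_mono:
  assumes "\<And>\<omega>. \<omega> \<in> space M \<Longrightarrow> \<bar>u \<omega>\<bar> \<le> \<bar>v \<omega>\<bar>"
  shows "L1_norm M u \<le> L1_norm M v"
  unfolding L1_norm_def by (intro nn_integral_mono ennreal_leI assms)

lemma uniformly_integrable_Un:
  assumes X: "uniformly_integrable M X" and Y: "uniformly_integrable M Y"
  shows "uniformly_integrable M (X \<union> Y)"
proof (rule uniformly_integrableI)
  show "integrable M u" if "u \<in> X \<union> Y" for u
    using that X Y by (auto simp: uniformly_integrable_def)
  show "L1_norm M u \<le> max (SUP u\<in>X. L1_norm M u) (SUP u\<in>Y. L1_norm M u)" if "u \<in> X \<union> Y" for u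
    using that by (auto simp: le_max_iff_disj intro: SUP_upper)
  show "max (SUP u\<in>X. L1_norm M u) (SUP u\<in>Y. L1_norm M u) < \<infinity>"
    using X Y by (auto simp: uniformly_integrable_def)
next
  fix \<epsilon> :: real assume e: "\<epsilon> > 0"
  from X e obtain \<eta>1 K1 where 1: "\<eta>1 > 0" "K1 \<in> sets M" "emeasure M K1 < \<infinity>"
    "\<And>u A. u \<in> X \<Longrightarrow> A \<in> sets M \<Longrightarrow> emeasure M A \<le> ennreal \<eta>1 \<Longrightarrow>
        L1_norm M (\<lambda>\<omega>. u \<omega> * indicator A \<omega>) \<le> ennreal \<epsilon>"
    "\<And>u. u \<in> X \<Longrightarrow> L1_norm M (\<lambda>\<omega>. u \<omega> * indicator (space M - K1) \<omega>) \<le> ennreal \<epsilon>"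
    by (rule uniformly_integrableE) blast
  from Y e obtain \<eta>2 K2 where 2: "\<eta>2 > 0" "K2 \<in> sets M" "emeasure M K2 < \<infinity>"
    "\<And>u A. u \<in> Y \<Longrightarrow> A \<in> sets M \<Longrightarrow> emeasure M A \<le> ennreal \<eta>2 \<Longrightarrow>
        L1_norm M (\<lambda>\<omega>. u \<omega> * indicator A \<omega>) \<le> ennreal \<epsilon>"
    "\<And>u. u \<in> Y \<Longrightarrow> L1_norm M (\<lambda>\<omega>. u \<omega> * indicator (space M - K2) \<omega>) \<le> ennreal \<epsilon>"
    by (rule uniformly_integrableE) blast
  have fin: "emeasure M (K1 \<union> K2) < \<infinity>"
    using emeasure_subadditive[of K1 M K2] 1 2
    by (auto intro: order_le_less_trans)
  have eta: "m \<le> ennreal \<eta>1" "m \<le> ennreal \<eta>2" if "m \<le> ennreal (min \<eta>1 \<eta>2)" for m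
    using that by (meson ennreal_leI min.cobounded1 min.cobounded2 order_trans)+
  have "L1_norm M (\<lambda>\<omega>. u \<omega> * indicator (space M - (K1 \<union> K2)) \<omega>)
        \<le> L1_norm M (\<lambda>\<omega>. u \<omega> * indicator (space M - K1) \<omega>)"
    "L1_norm M (\<lambda>\<omega>. u \<omega> * indicator (space M - (K1 \<union> K2)) \<omega>)
        \<le> L1_norm M (\<lambda>\<omega>. u \<omega> * indicator (space M - K2) \<omega>)" for u
    by (auto intro!: L1_norm_mono split: split_indicator)
  then have outside:
    "L1_norm M (\<lambda>\<omega>. u \<omega> * indicator (space M - (K1 \<union> K2)) \<omega>) \<le> ennreal \<epsilon>" if "u \<in> X \<union> Y" for u
    using that 1(5) 2(5) by (meson UnE order_trans)
  show "\<exists>\<eta>::real. \<exists>K. \<eta> > 0 \<and> K \<in> sets M \<and> emeasure M K < \<infinity> \<and>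
        (\<forall>u\<in>X \<union> Y. (\<forall>A\<in>sets M. emeasure M A \<le> ennreal \<eta> \<longrightarrow>
                   L1_norm M (\<lambda>\<omega>. u \<omega> * indicator A \<omega>) \<le> ennreal \<epsilon>) \<and>
               L1_norm M (\<lambda>\<omega>. u \<omega> * indicator (space M - K) \<omega>) \<le> ennreal \<epsilon>)"
    using 1(1,2,4) 2(1,2,4) fin eta outside
    by (intro exI[of _ "min \<eta>1 \<eta>2"] exI[of _ "K1 \<union> K2"]) auto
qed

lemma uniformly_integrable_empty: "uniformly_integrable M {}"
  by (rule uniformly_integrableI[where C = 0]) (auto intro: exI[of _ 1] exI[of _ "{}"])

text \<open>The excess \<open>(|g| - |u|)\<^sup>+\<close> contributes at most its total mass to an integral over any set, so
  the constants \<open>\<eta>\<close> and \<open>K\<close> that serve \<open>Y\<close> for \<open>\<epsilon> / 2\<close> serve \<open>X\<close> for \<open>\<epsilon>\<close>. The positive part is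
  taken implicitly by \<open>ennreal\<close>.\<close>

lemma uniformly_integrable_approx_dominated:
  fixes X :: "('a \<Rightarrow> real) set"
  assumes meas: "\<And>g. g \<in> X \<Longrightarrow> g \<in> borel_measurable M"
    and approx: "\<And>\<epsilon>::real. \<epsilon> > 0 \<Longrightarrow> \<exists>Y. uniformly_integrable M Y \<and>
        (\<forall>g\<in>X. \<exists>u\<in>Y. (\<integral>\<^sup>+\<omega>. ennreal (\<bar>g \<omega>\<bar> - \<bar>u \<omega>\<bar>) \<partial>M) \<le> ennreal \<epsilon>)"
  shows "uniformly_integrable M X"
proof -
  have split: "L1_norm M (\<lambda>\<omega>. g \<omega> * indicator A \<omega>)
      \<le> L1_norm M (\<lambda>\<omega>. u \<omega> * indicator A \<omega>) + (\<integral>\<^sup>+\<omega>. ennreal (\<bar>g \<omega>\<bar> - \<bar>u \<omega>\<bar>) \<partial>M)"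
    if [measurable]: "g \<in> borel_measurable M" "u \<in> borel_measurable M" "A \<in> sets M" for g u A
  proof -
    have "L1_norm M (\<lambda>\<omega>. g \<omega> * indicator A \<omega>)
        \<le> (\<integral>\<^sup>+\<omega>. ennreal \<bar>u \<omega> * indicator A \<omega>\<bar> + ennreal (\<bar>g \<omega>\<bar> - \<bar>u \<omega>\<bar>) \<partial>M)"
      unfolding L1_norm_def
    proof (rule nn_integral_mono)
      fix \<omega>
      have "\<bar>g \<omega> * indicator A \<omega>\<bar> \<le> \<bar>u \<omega> * indicator A \<omega>\<bar> + max 0 (\<bar>g \<omega>\<bar> - \<bar>u \<omega>\<bar>)"
        by (auto split: split_indicator)
      then have "ennreal \<bar>g \<omega> * indicator A \<omega>\<bar>
          \<le> ennreal (\<bar>u \<omega> * indicator A \<omega>\<bar> + max 0 (\<bar>g \<omega>\<bar> - \<bar>u \<omega>\<bar>))"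
        by (rule ennreal_leI)
      also have "\<dots> = ennreal \<bar>u \<omega> * indicator A \<omega>\<bar> + ennreal (\<bar>g \<omega>\<bar> - \<bar>u \<omega>\<bar>)"
        by (subst ennreal_plus) (auto simp: max_def ennreal_neg)
      finally show "ennreal \<bar>g \<omega> * indicator A \<omega>\<bar>
          \<le> ennreal \<bar>u \<omega> * indicator A \<omega>\<bar> + ennreal (\<bar>g \<omega>\<bar> - \<bar>u \<omega>\<bar>)" .
    qed
    also have "\<dots> = L1_norm M (\<lambda>\<omega>. u \<omega> * indicator A \<omega>) + (\<integral>\<^sup>+\<omega>. ennreal (\<bar>g \<omega>\<bar> - \<bar>u \<omega>\<bar>) \<partial>M)"
      unfolding L1_norm_def by (rule nn_integral_add) measurable
    finally show ?thesis .
  qed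
  from approx[of 1] obtain Y where Y: "uniformly_integrable M Y"
    and YX: "\<And>g. g \<in> X \<Longrightarrow> \<exists>u\<in>Y. (\<integral>\<^sup>+\<omega>. ennreal (\<bar>g \<omega>\<bar> - \<bar>u \<omega>\<bar>) \<partial>M) \<le> ennreal 1"
    by auto
  define C where "C = (SUP u\<in>Y. L1_norm M u) + ennreal 1"
  have C: "C < \<infinity>"
    using Y by (auto simp: C_def uniformly_integrable_def)
  have bdd: "L1_norm M g \<le> C" if "g \<in> X" for g
  proof -
    from YX[OF that] obtain u where u: "u \<in> Y" "(\<integral>\<^sup>+\<omega>. ennreal (\<bar>g \<omega>\<bar> - \<bar>u \<omega>\<bar>) \<partial>M) \<le> ennreal 1"
      by blast
    have whole: "L1_norm M (\<lambda>\<omega>. h \<omega> * indicator (space M) \<omega>) = L1_norm M h" for h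
      unfolding L1_norm_def by (rule nn_integral_cong) auto
    have "L1_norm M g \<le> L1_norm M u + (\<integral>\<^sup>+\<omega>. ennreal (\<bar>g \<omega>\<bar> - \<bar>u \<omega>\<bar>) \<partial>M)"
      using split[of g u "space M"] meas[OF that] Y u(1)
      by (auto simp: whole uniformly_integrable_def)
    also have "\<dots> \<le> C"
      unfolding C_def by (intro add_mono u SUP_upper)
    finally show ?thesis .
  qed
  show ?thesis
  proof (rule uniformly_integrableI[OF _ bdd C])
    show "integrable M g" if "g \<in> X" for g
      using bdd[OF that] C meas[OF that]
      by (auto simp: integrable_iff_bounded L1_norm_def intro: order_le_less_trans)
  next
    fix \<epsilon> :: real assume "\<epsilon> > 0"
    then have half: "\<epsilon> / 2 > 0" by simp
    from approx[OF half] obtain Y where Y: "uniformly_integrable M Y"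
      and YX: "\<And>g. g \<in> X \<Longrightarrow> \<exists>u\<in>Y. (\<integral>\<^sup>+\<omega>. ennreal (\<bar>g \<omega>\<bar> - \<bar>u \<omega>\<bar>) \<partial>M) \<le> ennreal (\<epsilon> / 2)"
      by auto
    from Y half obtain \<eta> K where K: "\<eta> > 0" "K \<in> sets M" "emeasure M K < \<infinity>"
      "\<And>u A. u \<in> Y \<Longrightarrow> A \<in> sets M \<Longrightarrow> emeasure M A \<le> ennreal \<eta> \<Longrightarrow>
          L1_norm M (\<lambda>\<omega>. u \<omega> * indicator A \<omega>) \<le> ennreal (\<epsilon> / 2)"
      "\<And>u. u \<in> Y \<Longrightarrow> L1_norm M (\<lambda>\<omega>. u \<omega> * indicator (space M - K) \<omega>) \<le> ennreal (\<epsilon> / 2)"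
      by (rule uniformly_integrableE) blast
    have step: "L1_norm M (\<lambda>\<omega>. g \<omega> * indicator A \<omega>) \<le> ennreal \<epsilon>"
      if g: "g \<in> X" and A: "A \<in> sets M"
        and Ysmall: "\<And>u. u \<in> Y \<Longrightarrow> L1_norm M (\<lambda>\<omega>. u \<omega> * indicator A \<omega>) \<le> ennreal (\<epsilon> / 2)" for g A
    proof -
      from YX[OF g] obtain u
        where u: "u \<in> Y" "(\<integral>\<^sup>+\<omega>. ennreal (\<bar>g \<omega>\<bar> - \<bar>u \<omega>\<bar>) \<partial>M) \<le> ennreal (\<epsilon> / 2)"
        by blast
      have "L1_norm M (\<lambda>\<omega>. g \<omega> * indicator A \<omega>)
          \<le> L1_norm M (\<lambda>\<omega>. u \<omega> * indicator A \<omega>) + (\<integral>\<^sup>+\<omega>. ennreal (\<bar>g \<omega>\<bar> - \<bar>u \<omega>\<bar>) \<partial>M)"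
        using meas[OF g] Y u(1) A by (intro split) (auto simp: uniformly_integrable_def)
      also have "\<dots> \<le> ennreal (\<epsilon> / 2) + ennreal (\<epsilon> / 2)"
        by (intro add_mono u Ysmall)
      also have "\<dots> = ennreal \<epsilon>"
        using half by (subst ennreal_plus[symmetric]) auto
      finally show ?thesis .
    qed
    show "\<exists>\<eta>::real. \<exists>K. \<eta> > 0 \<and> K \<in> sets M \<and> emeasure M K < \<infinity> \<and>
        (\<forall>g\<in>X. (\<forall>A\<in>sets M. emeasure M A \<le> ennreal \<eta> \<longrightarrow>
                   L1_norm M (\<lambda>\<omega>. g \<omega> * indicator A \<omega>) \<le> ennreal \<epsilon>) \<and>
               L1_norm M (\<lambda>\<omega>. g \<omega> * indicator (space M - K) \<omega>) \<le> ennreal \<epsilon>)"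
      using K by (intro exI[of _ \<eta>] exI[of _ K]) (auto intro!: step)
  qed
qed

text \<open>A bounded function vanishing off a set of finite measure is uniformly integrable by
  inspection: that set is \<open>K\<close>, and \<open>\<eta>\<close> is \<open>\<epsilon>\<close> divided by the bound.\<close>

lemma uniformly_integrable_bounded_support:
  fixes u :: "'a \<Rightarrow> real"
  assumes [measurable]: "u \<in> borel_measurable M" "K \<in> sets M"
    and K: "emeasure M K < \<infinity>"
    and supp: "\<And>\<omega>. \<omega> \<in> space M - K \<Longrightarrow> u \<omega> = 0"
    and B: "B > 0" "\<And>\<omega>. \<bar>u \<omega>\<bar> \<le> B"
  shows "uniformly_integrable M {u}"
proof -
  have on: "L1_norm M (\<lambda>\<omega>. u \<omega> * indicator A \<omega>) \<le> ennreal B * emeasure M A"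
    if [measurable]: "A \<in> sets M" for A
  proof -
    have "L1_norm M (\<lambda>\<omega>. u \<omega> * indicator A \<omega>) \<le> (\<integral>\<^sup>+\<omega>. ennreal B * indicator A \<omega> \<partial>M)"
      unfolding L1_norm_def using B
      by (intro nn_integral_mono) (auto split: split_indicator intro: ennreal_leI)
    also have "\<dots> = ennreal B * emeasure M A"
      by (rule nn_integral_cmult_indicator) measurable
    finally show ?thesis .
  qed
  have "L1_norm M u = L1_norm M (\<lambda>\<omega>. u \<omega> * indicator K \<omega>)"
    unfolding L1_norm_def using supp by (intro nn_integral_cong) (auto split: split_indicator)
  then have bdd: "L1_norm M u \<le> ennreal B * emeasure M K"
    using on[of K] by simp
  have fin: "ennreal B * emeasure M K < \<infinity>"
    using K by (simp add: ennreal_mult_less_top)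
  show ?thesis
  proof (rule uniformly_integrableI[OF _ _ fin])
    show "integrable M v" if "v \<in> {u}" for v
      using that bdd fin
      by (auto simp: integrable_iff_bounded L1_norm_def intro: order_le_less_trans)
    show "L1_norm M v \<le> ennreal B * emeasure M K" if "v \<in> {u}" for v
      using that bdd by simp
  next
    fix \<epsilon> :: real assume e: "\<epsilon> > 0"
    have "L1_norm M (\<lambda>\<omega>. u \<omega> * indicator A \<omega>) \<le> ennreal \<epsilon>"
      if "A \<in> sets M" "emeasure M A \<le> ennreal (\<epsilon> / B)" for A
    proof -
      have "L1_norm M (\<lambda>\<omega>. u \<omega> * indicator A \<omega>) \<le> ennreal B * ennreal (\<epsilon> / B)"
        using on[OF that(1)] mult_left_mono[OF that(2), of "ennreal B"] by (meson order_trans zero_le)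
      also have "\<dots> = ennreal \<epsilon>"
        using e B(1) by (subst ennreal_mult[symmetric]) auto
      finally show ?thesis .
    qed
    moreover have "L1_norm M (\<lambda>\<omega>. u \<omega> * indicator (space M - K) \<omega>) = L1_norm M (\<lambda>\<omega>. 0)"
      unfolding L1_norm_def using supp by (intro nn_integral_cong) (auto split: split_indicator)
    ultimately show "\<exists>\<eta>::real. \<exists>K. \<eta> > 0 \<and> K \<in> sets M \<and> emeasure M K < \<infinity> \<and>
        (\<forall>v\<in>{u}. (\<forall>A\<in>sets M. emeasure M A \<le> ennreal \<eta> \<longrightarrow>
                   L1_norm M (\<lambda>\<omega>. v \<omega> * indicator A \<omega>) \<le> ennreal \<epsilon>) \<and>
               L1_norm M (\<lambda>\<omega>. v \<omega> * indicator (space M - K) \<omega>) \<le> ennreal \<epsilon>)"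
      using K e B(1) by (intro exI[of _ "\<epsilon> / B"] exI[of _ K]) (auto simp: L1_norm_def)
  qed
qed

text \<open>Cutting \<open>u\<close> off where \<open>|u|\<close> is above \<open>k\<close> or below \<open>1 / k\<close> leaves a bounded function with
  support of finite measure (Markov's inequality), and by dominated convergence the part cut off
  tends to \<open>0\<close> in \<open>L\<^sub>1\<close>.\<close>

lemma uniformly_integrable_singleton:
  assumes u: "integrable M u"
  shows "uniformly_integrable M {u :: 'a \<Rightarrow> real}"
proof (rule uniformly_integrable_approx_dominated)
  have [measurable]: "u \<in> borel_measurable M" using u by simp
  then show "g \<in> borel_measurable M" if "g \<in> {u}" for g using that by simp
  fix \<epsilon> :: real assume e: "\<epsilon> > 0"
  define K where "K k = {\<omega> \<in> space M. 1 / real (Suc k) \<le> \<bar>u \<omega>\<bar>}" for k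
  define w where "w k \<omega> = (if \<omega> \<in> K k \<and> \<bar>u \<omega>\<bar> \<le> real (Suc k) then u \<omega> else 0)" for k \<omega>
  have [measurable]: "K k \<in> sets M" for k unfolding K_def by measurable
  have [measurable]: "w k \<in> borel_measurable M" for k unfolding w_def by measurable
  have ptw: "(\<lambda>k. \<bar>u \<omega>\<bar> - \<bar>w k \<omega>\<bar>) \<longlonglongrightarrow> 0" if \<omega>: "\<omega> \<in> space M" for \<omega>
  proof (cases "u \<omega> = 0")
    case True
    then have "w k \<omega> = 0" for k by (simp add: w_def)
    with True show ?thesis by simp
  next
    case False
    have "\<forall>\<^sub>F k in sequentially. 1 / real (Suc k) < \<bar>u \<omega>\<bar>"
      using LIMSEQ_inverse_real_of_nat False
      by (auto simp: inverse_eq_divide intro: order_tendstoD(2))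
    moreover have "\<forall>\<^sub>F k in sequentially. \<bar>u \<omega>\<bar> < real (Suc k)"
      using filterlim_compose[OF filterlim_real_sequentially filterlim_Suc]
      by (auto simp: filterlim_at_top_dense)
    ultimately have "\<forall>\<^sub>F k in sequentially. \<bar>u \<omega>\<bar> - \<bar>w k \<omega>\<bar> = 0"
      by eventually_elim (use \<omega> in \<open>auto simp: w_def K_def\<close>)
    then show ?thesis by (rule tendsto_eventually)
  qed
  have "(\<lambda>k. \<integral>\<^sup>+\<omega>. ennreal (\<bar>u \<omega>\<bar> - \<bar>w k \<omega>\<bar>) \<partial>M) \<longlonglongrightarrow> (\<integral>\<^sup>+\<omega>. 0 \<partial>M)"
  proof (rule nn_integral_dominated_convergence[where w = "\<lambda>\<omega>. ennreal \<bar>u \<omega>\<bar>"])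
    show "AE \<omega> in M. (\<lambda>k. ennreal (\<bar>u \<omega>\<bar> - \<bar>w k \<omega>\<bar>)) \<longlonglongrightarrow> 0"
      using ptw by (intro AE_I2) (metis ennreal_0 tendsto_ennrealI)
    show "(\<integral>\<^sup>+\<omega>. ennreal \<bar>u \<omega>\<bar> \<partial>M) < \<infinity>"
      using u by (simp add: integrable_iff_bounded)
  qed (auto intro!: ennreal_leI)
  then have "\<forall>\<^sub>F k in sequentially. (\<integral>\<^sup>+\<omega>. ennreal (\<bar>u \<omega>\<bar> - \<bar>w k \<omega>\<bar>) \<partial>M) < ennreal \<epsilon>"
    using e by (intro order_tendstoD(2)) auto
  then obtain k where k: "(\<integral>\<^sup>+\<omega>. ennreal (\<bar>u \<omega>\<bar> - \<bar>w k \<omega>\<bar>) \<partial>M) < ennreal \<epsilon>"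
    using eventually_happens'[OF sequentially_bot] by blast
  have "uniformly_integrable M {w k}"
  proof (rule uniformly_integrable_bounded_support)
    show "emeasure M (K k) < \<infinity>"
    proof -
      have "emeasure M (K k) = emeasure M {\<omega> \<in> space M. 1 \<le> ennreal (real (Suc k)) * ennreal \<bar>u \<omega>\<bar>}"
        by (rule arg_cong[where f = "emeasure M"])
           (auto simp: K_def ennreal_mult[symmetric] field_simps simp del: of_nat_Suc)
      also have "\<dots> \<le> ennreal (real (Suc k)) * (\<integral>\<^sup>+\<omega>. ennreal \<bar>u \<omega>\<bar> * indicator (space M) \<omega> \<partial>M)"
        by (rule nn_integral_Markov_inequality) measurable
      also have "\<dots> < \<infinity>"
        using u by (simp add: integrable_iff_bounded ennreal_mult_less_top del: of_nat_Suc)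
      finally show ?thesis .
    qed
    show "\<bar>w k \<omega>\<bar> \<le> real (Suc k)" for \<omega> by (simp add: w_def)
  qed (auto simp: w_def)
  with k show "\<exists>Y. uniformly_integrable M Y \<and>
      (\<forall>g\<in>{u}. \<exists>v\<in>Y. (\<integral>\<^sup>+\<omega>. ennreal (\<bar>g \<omega>\<bar> - \<bar>v \<omega>\<bar>) \<partial>M) \<le> ennreal \<epsilon>)"
    by (intro exI[of _ "{w k}"]) auto
qed

lemma uniformly_integrable_finite:
  assumes "finite X" "\<And>u. u \<in> X \<Longrightarrow> integrable M u"
  shows "uniformly_integrable M X"
  using assms
proof (induction X rule: finite_induct)
  case empty
  show ?case by (rule uniformly_integrable_empty)
next
  case (insert u X)
  then show ?case
    using uniformly_integrable_Un[OF uniformly_integrable_singleton[of M u]] by force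
qed

section \<open>Young integrands\<close>

text \<open>Convexity on the segment from \<open>0\<close> to \<open>e\<close>, together with \<open>F 0 = 0\<close>.\<close>

lemma young_function_contract:
  assumes F: "young_function F" and t: "0 < t" "t < 1"
  shows "F (t *\<^sub>R e) \<le> F e"
proof -
  have "F (t *\<^sub>R e + (1 - t) *\<^sub>R 0) \<le> ereal t * F e + ereal (1 - t) * F 0"
    using F t unfolding young_function_def by blast
  also have "\<dots> = ereal t * F e"
    using F by (simp add: young_function_def)
  also have "\<dots> \<le> 1 * F e"
    using F t by (intro ereal_mult_right_mono) (auto simp: young_function_def)
  finally show ?thesis by simp
qed

text \<open>Both the norm and the upper integral are infima that need not be attained. Hence \<open>R\<close> is taken
  strictly above the norm, which yields some \<open>t < R\<close> with \<open>I\<^sub>\<phi>(x / t) \<le> 1\<close>; and a majorant is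
  available with integral below any bound greater than \<open>1\<close>, such as \<open>2\<close>. Passing from \<open>x / t\<close> to
  \<open>x / R\<close> only decreases \<open>\<phi>\<close>.\<close>

lemma young_norm_less_imp_majorant:
  assumes \<phi>: "young_integrand M \<phi>" and x: "x \<in> L_young M \<phi>" and R: "young_norm M \<phi> x < R"
  obtains v where "integrable M v" "AE \<omega> in M. dilate (1 / R) \<phi> \<omega> (x \<omega>) \<le> ereal (v \<omega>)"
    "(\<integral>\<omega>. v \<omega> \<partial>M) < 2"
proof -
  have "{t. t > 0 \<and> x \<in> scaled_unit_sublevel M \<phi> t} \<noteq> {}"
    using x by (auto simp: L_young_def)
  from cInf_lessD[OF this R[unfolded young_norm_def]]
  obtain t where t: "0 < t" "t < R" "x \<in> scaled_unit_sublevel M \<phi> t"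
    by blast
  then obtain y where y: "integral_functional M \<phi> y \<le> 1" and xy: "x = (\<lambda>\<omega>. t *\<^sub>R y \<omega>)"
    unfolding scaled_unit_sublevel_def by blast
  have "upper_integral M (\<lambda>\<omega>. \<phi> \<omega> (y \<omega>)) < 2"
    using y unfolding integral_functional_def by (rule order_le_less_trans) simp
  then obtain v where v: "integrable M v" "AE \<omega> in M. \<phi> \<omega> (y \<omega>) \<le> ereal (v \<omega>)"
    "ereal (\<integral>\<omega>. v \<omega> \<partial>M) < 2"
    unfolding upper_integral_def Inf_less_iff by blast
  have contract: "dilate (1 / R) \<phi> \<omega> (x \<omega>) \<le> \<phi> \<omega> (y \<omega>)" if "\<omega> \<in> space M" for \<omega>
    using young_function_contract[of "\<phi> \<omega>" "t / R" "y \<omega>"] \<phi> that t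
    by (simp add: young_integrand_def dilate_def xy)
  have "AE \<omega> in M. dilate (1 / R) \<phi> \<omega> (x \<omega>) \<le> ereal (v \<omega>)"
    using v(2) AE_space by eventually_elim (blast intro: order_trans contract)
  moreover have "(\<integral>\<omega>. v \<omega> \<partial>M) < 2"
    using v(3) by (metis ereal_less(2) less_ereal.simps(1) numeral_eq_ereal)
  ultimately show thesis using that v(1) by blast
qed

text \<open>Finiteness of the majorant \<open>v\<close> is what turns the extended-real lower bound into a real
  bound.\<close>

lemma negative_part_le:
  assumes le: "- (ereal \<epsilon> * p) - ereal u \<le> r" and p: "p \<le> ereal v"
    and nonneg: "0 \<le> \<epsilon>" "0 \<le> p" "0 \<le> u"
  shows "negative_part r < \<infinity>" "real_of_ereal (negative_part r) \<le> \<epsilon> * v + u"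
proof -
  obtain q where q: "p = ereal q" "0 \<le> q" "q \<le> v"
    using p nonneg(2) by (cases p) auto
  have "\<epsilon> * q \<le> \<epsilon> * v" "0 \<le> \<epsilon> * q" using q nonneg by (auto intro: mult_left_mono)
  then show "negative_part r < \<infinity>" "real_of_ereal (negative_part r) \<le> \<epsilon> * v + u"
    using le nonneg(3) by (cases r; simp add: negative_part_def q max_def; linarith)+
qed

lemma borel_measurable_negative_part_integrand:
  fixes f :: "'a \<Rightarrow> 'e::topological_space \<Rightarrow> ereal"
  assumes f: "measurable_integrand M f" and [measurable]: "x \<in> borel_measurable M"
  shows "(\<lambda>\<omega>. real_of_ereal (negative_part (f \<omega> (x \<omega>)))) \<in> borel_measurable M"
proof -
  have "(\<lambda>\<omega>. (\<omega>, x \<omega>)) \<in> M \<rightarrow>\<^sub>M M \<Otimes>\<^sub>M borel" by measurable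
  from measurable_compose[OF this f[unfolded measurable_integrand_def]]
  have [measurable]: "(\<lambda>\<omega>. f \<omega> (x \<omega>)) \<in> borel_measurable M" by simp
  show ?thesis unfolding negative_part_def by measurable
qed

section \<open>Lower compactness\<close>

theorem proposition8p4:
  fixes M :: "'a measure"
    and \<phi> :: "'a \<Rightarrow> 'e::{banach, second_countable_topology} \<Rightarrow> ereal"
    and f :: "nat \<Rightarrow> 'a \<Rightarrow> 'e \<Rightarrow> ereal"
  assumes "sigma_finite_measure M"
    and "complete_measure M"
    and "young_integrand M \<phi>"
    and "\<And>n. measurable_integrand M (f n)"
    and "\<And>\<epsilon> c :: real. \<epsilon> > 0 \<Longrightarrow> c > 0 \<Longrightarrow>
           \<exists>u :: nat \<Rightarrow> 'a \<Rightarrow> real.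
             (\<forall>n. AE \<omega> in M. 0 \<le> u n \<omega>) \<and>
             uniformly_integrable M (range u) \<and>
             (\<forall>\<^sub>F n in sequentially.
                integrand_ge M (f n)
                  (\<lambda>\<omega> e. - (ereal \<epsilon> * dilate c \<phi> \<omega> e) - ereal (u n \<omega>)))"
  shows "frechet_lower_compactness M (L_young M \<phi>) (young_norm M \<phi>) f"
proof -
  note \<phi> = assms(3) and f = assms(4) and minorant = assms(5)
  show ?thesis
    unfolding frechet_lower_compactness_def
  proof (intro allI impI, elim conjE exE)
    fix x :: "nat \<Rightarrow> 'a \<Rightarrow> 'e" and R0 :: real
    assume x: "\<forall>n. x n \<in> L_young M \<phi>" and R0: "\<forall>n. young_norm M \<phi> (x n) \<le> R0"
    define R where "R = max R0 0 + 1"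
    have R: "R > 0" "young_norm M \<phi> (x n) < R" for n
      using R0[rule_format, of n] by (auto simp: R_def)
    define g where "g n \<omega> = real_of_ereal (negative_part (f n \<omega> (x n \<omega>)))" for n \<omega>
    have g_meas: "g n \<in> borel_measurable M" for n
      using borel_measurable_negative_part_integrand[OF f, of "x n"] x
      by (auto simp: g_def[abs_def] L_young_def)
    have "\<exists>v. integrable M v \<and> (AE \<omega> in M. dilate (1 / R) \<phi> \<omega> (x n \<omega>) \<le> ereal (v \<omega>)) \<and>
        (\<integral>\<omega>. v \<omega> \<partial>M) < 2" for n
      using young_norm_less_imp_majorant[OF \<phi> x[rule_format] R(2)] by blast
    then obtain v where v: "\<And>n. integrable M (v n)"
      "\<And>n. AE \<omega> in M. dilate (1 / R) \<phi> \<omega> (x n \<omega>) \<le> ereal (v n \<omega>)"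
      "\<And>n. (\<integral>\<omega>. v n \<omega> \<partial>M) < 2"
      by metis
    have \<phi>_nonneg: "0 \<le> dilate (1 / R) \<phi> \<omega> e" if "\<omega> \<in> space M" for \<omega> e
      using \<phi> that by (auto simp: young_integrand_def young_function_def dilate_def)
    have v_nonneg: "AE \<omega> in M. 0 \<le> v n \<omega>" for n
      using v(2)[of n]
    proof (rule AE_mp, intro AE_I2 impI)
      fix \<omega> assume "\<omega> \<in> space M" "dilate (1 / R) \<phi> \<omega> (x n \<omega>) \<le> ereal (v n \<omega>)"
      then have "0 \<le> ereal (v n \<omega>)" using \<phi>_nonneg order_trans by blast
      then show "0 \<le> v n \<omega>" by simp
    qed
    have dominated: "\<exists>u N. uniformly_integrable M (range u) \<and>
        (\<forall>n\<ge>N. (AE \<omega> in M. negative_part (f n \<omega> (x n \<omega>)) < \<infinity>) \<and>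
               (\<integral>\<^sup>+\<omega>. ennreal (\<bar>g n \<omega>\<bar> - \<bar>u n \<omega>\<bar>) \<partial>M) \<le> ennreal (2 * \<epsilon>))"
      if e: "\<epsilon> > 0" for \<epsilon> :: real
    proof -
      have "1 / R > 0" using R by simp
      from minorant[OF e this] obtain u where u: "\<forall>n. AE \<omega> in M. 0 \<le> u n \<omega>"
        "uniformly_integrable M (range u)"
        "\<forall>\<^sub>F n in sequentially. integrand_ge M (f n)
            (\<lambda>\<omega> e. - (ereal \<epsilon> * dilate (1 / R) \<phi> \<omega> e) - ereal (u n \<omega>))"
        by blast
      from u(3) obtain N where N: "\<And>n. n \<ge> N \<Longrightarrow> AE \<omega> in M. \<forall>e.
          - (ereal \<epsilon> * dilate (1 / R) \<phi> \<omega> e) - ereal (u n \<omega>) \<le> f n \<omega> e"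
        unfolding integrand_ge_def eventually_sequentially by blast
      have "(AE \<omega> in M. negative_part (f n \<omega> (x n \<omega>)) < \<infinity>) \<and>
          (\<integral>\<^sup>+\<omega>. ennreal (\<bar>g n \<omega>\<bar> - \<bar>u n \<omega>\<bar>) \<partial>M) \<le> ennreal (2 * \<epsilon>)" if "n \<ge> N" for n
      proof -
        have bound: "AE \<omega> in M. negative_part (f n \<omega> (x n \<omega>)) < \<infinity> \<and>
            \<bar>g n \<omega>\<bar> - \<bar>u n \<omega>\<bar> \<le> \<epsilon> * v n \<omega>"
          using N[OF that] v(2)[of n] u(1)[rule_format, of n] AE_space
        proof eventually_elim
          case (elim \<omega>)
          have "0 \<le> g n \<omega>"
            unfolding g_def negative_part_def by (intro real_of_ereal_pos) simp
          moreover note negative_part_le[OF elim(1)[rule_format] elim(2) less_imp_le[OF e]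
              \<phi>_nonneg[OF elim(4)] elim(3)]
          ultimately show ?case
            using elim(3) unfolding g_def[symmetric] by auto
        qed
        then have "(\<integral>\<^sup>+\<omega>. ennreal (\<bar>g n \<omega>\<bar> - \<bar>u n \<omega>\<bar>) \<partial>M) \<le> (\<integral>\<^sup>+\<omega>. ennreal (\<epsilon> * v n \<omega>) \<partial>M)"
          by (rule nn_integral_mono_AE[OF eventually_mono]) (simp add: ennreal_leI)
        also have "\<dots> = ennreal (\<integral>\<omega>. \<epsilon> * v n \<omega> \<partial>M)"
          using v(1)[of n] v_nonneg[of n] e by (intro nn_integral_eq_integral) auto
        also have "\<dots> \<le> ennreal (2 * \<epsilon>)"
          using v(3)[of n] e by (intro ennreal_leI) simp
        finally show ?thesis using bound by auto
      qed
      then show ?thesis using u(2) by blast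
    qed
    from dominated[of 1] obtain u0 n0 where u0: "uniformly_integrable M (range u0)"
      and fin: "\<And>n. n \<ge> n0 \<Longrightarrow> AE \<omega> in M. negative_part (f n \<omega> (x n \<omega>)) < \<infinity>"
      and n0: "\<And>n. n \<ge> n0 \<Longrightarrow> (\<integral>\<^sup>+\<omega>. ennreal (\<bar>g n \<omega>\<bar> - \<bar>u0 n \<omega>\<bar>) \<partial>M) \<le> ennreal 2"
      by auto
    have g_int: "integrable M (g n)" if "n \<ge> n0" for n
    proof -
      have [measurable]: "u0 n \<in> borel_measurable M" "g n \<in> borel_measurable M"
        using u0 g_meas by (auto simp: uniformly_integrable_def)
      have excess: "integrable M (\<lambda>\<omega>. max 0 (\<bar>g n \<omega>\<bar> - \<bar>u0 n \<omega>\<bar>))"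
      proof (rule integrableI_nonneg)
        have "(\<integral>\<^sup>+\<omega>. ennreal (max 0 (\<bar>g n \<omega>\<bar> - \<bar>u0 n \<omega>\<bar>)) \<partial>M)
            = (\<integral>\<^sup>+\<omega>. ennreal (\<bar>g n \<omega>\<bar> - \<bar>u0 n \<omega>\<bar>) \<partial>M)"
          by (intro nn_integral_cong) (auto simp: max_def ennreal_neg)
        also have "\<dots> < \<infinity>" using n0[OF that] order_le_less_trans ennreal_less_top by fastforce
        finally show "(\<integral>\<^sup>+\<omega>. ennreal (max 0 (\<bar>g n \<omega>\<bar> - \<bar>u0 n \<omega>\<bar>)) \<partial>M) < \<infinity>" .
      qed auto
      have "integrable M (\<lambda>\<omega>. \<bar>u0 n \<omega>\<bar> + max 0 (\<bar>g n \<omega>\<bar> - \<bar>u0 n \<omega>\<bar>))"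
        using u0 excess by (intro Bochner_Integration.integrable_add)
          (auto simp: uniformly_integrable_def)
      then show ?thesis by (rule Bochner_Integration.integrable_bound) (auto intro!: AE_I2)
    qed
    have "uniformly_integrable M (g ` {n0..})"
    proof (rule uniformly_integrable_approx_dominated)
      fix \<epsilon> :: real assume "\<epsilon> > 0"
      then obtain u N where u: "uniformly_integrable M (range u)"
        and N: "\<And>n. n \<ge> N \<Longrightarrow> (\<integral>\<^sup>+\<omega>. ennreal (\<bar>g n \<omega>\<bar> - \<bar>u n \<omega>\<bar>) \<partial>M) \<le> ennreal \<epsilon>"
        using dominated[of "\<epsilon> / 2"] by auto
      have "uniformly_integrable M (g ` {n0..<N})"
        using g_int by (intro uniformly_integrable_finite) auto
      with u have Y: "uniformly_integrable M (range u \<union> g ` {n0..<N})"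
        by (rule uniformly_integrable_Un)
      have "\<exists>w\<in>range u \<union> g ` {n0..<N}. (\<integral>\<^sup>+\<omega>. ennreal (\<bar>g n \<omega>\<bar> - \<bar>w \<omega>\<bar>) \<partial>M) \<le> ennreal \<epsilon>"
        if "n \<ge> n0" for n
      proof (cases "n \<ge> N")
        case True
        then show ?thesis using N by blast
      next
        case False
        with that show ?thesis by (intro bexI[of _ "g n"]) auto
      qed
      with Y show "\<exists>Y. uniformly_integrable M Y \<and>
          (\<forall>h\<in>g ` {n0..}. \<exists>w\<in>Y. (\<integral>\<^sup>+\<omega>. ennreal (\<bar>h \<omega>\<bar> - \<bar>w \<omega>\<bar>) \<partial>M) \<le> ennreal \<epsilon>)"
        by (intro exI[of _ "range u \<union> g ` {n0..<N}"]) auto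
    qed (use g_meas in auto)
    then show "\<exists>n0. (\<forall>n\<ge>n0. AE \<omega> in M. negative_part (f n \<omega> (x n \<omega>)) < \<infinity>) \<and>
        uniformly_integrable M
          ((\<lambda>n \<omega>. real_of_ereal (negative_part (f n \<omega> (x n \<omega>)))) ` {n0..})"
      using fin unfolding g_def[abs_def] by blast
  qed
qed

end
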